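(* Let $\varrho$ be an aperiodic primitive bijective constant-length substitution on a finite alphabet $\mathcal{A}$ and let $w\in\mathcal{A}^{\mathbb{N}}$ be a one-sided fixed point of $\varrho$. Then there exist an increasing sequence $\{d_n\}\subset\mathbb{N}$ and a real number $\alpha$ with $0<\alpha\leqslant 1$ such that $A_w(d_n)\gtrsim d_n^{\alpha}$.
   Context: $\mathbb{N}=\mathbb{Z}_{\geqslant 0}$. A substitution on a finite alphabet $\mathcal{A}$ is a map $\varrho\colon\mathcal{A}\to\mathcal{A}^+$ ($\mathcal{A}^+$ = non-empty finite words), extended to finite and one-sided infinite words by concatenation; $\varrho^n$ is its $n$-th iterate. It has constant length $L$ if $|\varrho(a)|=L$ for all $a\in\mathcal{A}$; its $i$-th column ($0\leqslant i\leqslant L-1$) is the map $\varrho_i\colon\mathcal{A}\to\mathcal{A}$ sending $a$ to the $i$-th letter of $\varrho(a)$ (indices start at $0$). It is bijective if every column is a bijection of $\mathcal{A}$. It is primitive if there is $n$ such that for every $a\in\mathcal{A}$ the word $\varrho^n(a)$ contains all letters of $\mathcal{A}$. A (one-sided) fixed point is $w\in\mathcal{A}^{\mathbb{N}}$ with $\varrho(w)=w$. The substitution is aperiodic if it has no periodic fixed point, i.e. no fixed point of the form $v^\infty$ with $v$ a finite word. For $w=w_0w_1w_2\cdots\in\mathcal{A}^{\mathbb{N}}$ and $d\geqslant 1$, a monochromatic arithmetic progression of difference $d$ and length $M$ in $w$ is given by a start $k\in\mathbb{N}$ with $w_k=w_{k+dn}$ for $0\leqslant n\leqslant M-1$. $A_w(d)$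 is the maximum (supremum, in $\mathbb{N}\cup\{\infty\}$) length of a monochromatic arithmetic progression of difference $d$ occurring in $w$. For $f,g\colon\mathbb{N}\to\mathbb{R}_{>0}$: $f(n)\sim g(n)$ means $\lim_{n\to\infty}f(n)/g(n)=1$, and $f(n)\gtrsim g(n)$ means there is $h\colon\mathbb{N}\to\mathbb{R}_{>0}$ with $f(n)\geqslant h(n)$ for all $n$ and $h(n)\sim g(n)$. Here these are used for $f(n)=A_w(d_n)$, $g(n)=d_n^\alpha$. *)

theory Defs
  imports Complex_Main "HOL-Library.Stream" "HOL-Library.Extended_Nat"
    "HOL-Library.Landau_Symbols"
begin

text \<open>
  The alphabet is a finite type \<open>'a\<close>, finite words are lists and one-sided infinite words are
  streams, with letters indexed from \<open>0\<close> by \<open>!\<close> and \<open>!!\<close>.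
\<close>

definition substitution :: "('a \<Rightarrow> 'a list) \<Rightarrow> bool" where
  "substitution \<rho> \<longleftrightarrow> (\<forall>a. \<rho> a \<noteq> [])"

definition subst_word :: "('a \<Rightarrow> 'a list) \<Rightarrow> 'a list \<Rightarrow> 'a list" where
  "subst_word \<rho> u = concat (map \<rho> u)"

text \<open>
  The constant \<open>flat\<close> concatenates a stream of lists; it is only meaningful when the lists are
  non-empty, which is the case for a substitution.
\<close>

definition subst_stream :: "('a \<Rightarrow> 'a list) \<Rightarrow> 'a stream \<Rightarrow> 'a stream" where
  "subst_stream \<rho> w = flat (smap \<rho> w)"

definition constant_length :: "('a \<Rightarrow> 'a list) \<Rightarrow> nat \<Rightarrow> bool" where
  "constant_length \<rho> L \<longleftrightarrow> (\<forall>a. length (\<rho> a) = L)"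

definition column :: "('a \<Rightarrow> 'a list) \<Rightarrow> nat \<Rightarrow> 'a \<Rightarrow> 'a" where
  "column \<rho> i a = \<rho> a ! i"

definition bijective_subst :: "('a \<Rightarrow> 'a list) \<Rightarrow> nat \<Rightarrow> bool" where
  "bijective_subst \<rho> L \<longleftrightarrow> (\<forall>i<L. bij (column \<rho> i))"

definition primitive_subst :: "('a \<Rightarrow> 'a list) \<Rightarrow> bool" where
  "primitive_subst \<rho> \<longleftrightarrow> (\<exists>n. \<forall>a. set ((subst_word \<rho> ^^ n) [a]) = UNIV)"

definition fixed_point :: "('a \<Rightarrow> 'a list) \<Rightarrow> 'a stream \<Rightarrow> bool" where
  "fixed_point \<rho> w \<longleftrightarrow> subst_stream \<rho> w = w"

text \<open>For non-empty \<open>v\<close>, \<open>cycle v\<close> is the periodic word \<open>vvv\<dots>\<close>.\<close>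

definition aperiodic_subst :: "('a \<Rightarrow> 'a list) \<Rightarrow> bool" where
  "aperiodic_subst \<rho> \<longleftrightarrow> \<not> (\<exists>v. v \<noteq> [] \<and> fixed_point \<rho> (cycle v))"

definition mono_ap :: "'a stream \<Rightarrow> nat \<Rightarrow> nat \<Rightarrow> nat \<Rightarrow> bool" where
  "mono_ap w d k M \<longleftrightarrow> (\<forall>n<M. w !! k = w !! (k + d * n))"

definition max_ap_length :: "'a stream \<Rightarrow> nat \<Rightarrow> enat" where
  "max_ap_length w d = Sup {enat M | M. \<exists>k. mono_ap w d k M}"

text \<open>Meant for positive \<open>f\<close> and \<open>g\<close>: then the last condition says that \<open>h n / g n\<close> tends to \<open>1\<close>.\<close>

definition asymp_ge :: "(nat \<Rightarrow> real) \<Rightarrow> (nat \<Rightarrow> real) \<Rightarrow> bool" where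
  "asymp_ge f g \<longleftrightarrow>
     (\<exists>h. (\<forall>n. 0 < h n) \<and> (\<forall>n. h n \<le> f n) \<and> h \<sim>[sequentially] g)"

end

theory Submission
  imports Defs "HOL-Number_Theory.Cong"
begin

text \<open>
  Put \<open>X = L ^ n\<close>. For \<open>k < X\<close> the letter at position \<open>X * q + k\<close> is the image of the letter at
  position \<open>q\<close> under a permutation \<open>f\<close> of the alphabet that does not depend on \<open>q\<close>. Hence, if
  \<open>d = 1 + X + \<dots> + X ^ s\<close>, the letter at position \<open>k * d\<close> is \<open>(f ^^ Suc s) (w !! 0)\<close>, which is
  \<open>w !! 0\<close> once \<open>Suc s\<close> is a common period of all permutations. So \<open>w\<close> contains a monochromatic
  progression of difference \<open>d \<sim> X ^ s\<close> and length \<open>X\<close>, and \<open>\<alpha> = 1 / s\<close> works.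

  The progressions of difference \<open>d\<close> are bounded because \<open>d\<close> is coprime to \<open>L\<close>: a progression in
  the letter \<open>a\<close> longer than \<open>L ^ m\<close> meets every residue class modulo \<open>L ^ m\<close>, and comparing it with
  the prefix of \<open>w\<close> of length \<open>L ^ m\<close> shows that the set of occurrences of \<open>a\<close> in this prefix is
  closed under adding \<open>d\<close>. If this holds for all \<open>m\<close>, primitivity carries it over to all
  letters, so that \<open>w\<close> is periodic.
\<close>

section \<open>Letters of a fixed point through the columns of the substitution\<close>

lemma flat_snth_constant_length:
  assumes "\<And>n. length (s !! n) = L" and "i < L"
  shows "flat s !! (L * m + i) = s !! m ! i"
  using assms(1)
proof (induction m arbitrary: s)
  case 0
  have "length (shd s) = L" using 0[of 0] by simp
  then have "shd s \<noteq> []" using \<open>i < L\<close> by auto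
  then have "flat s = shd s @- flat (stl s)" by (metis flat_unfold)
  then show ?case using \<open>length (shd s) = L\<close> \<open>i < L\<close> by simp
next
  case (Suc m)
  have len: "length (shd s) = L" using Suc.prems[of 0] by simp
  then have "shd s \<noteq> []" using \<open>i < L\<close> by auto
  then have "flat s = shd s @- flat (stl s)" by (metis flat_unfold)
  then have "flat s !! (L * Suc m + i) = flat (stl s) !! (L * m + i)"
    using len by (simp add: algebra_simps)
  also have "\<dots> = stl s !! m ! i"
  proof (rule Suc.IH)
    show "length (stl s !! n) = L" for n using Suc.prems[of "Suc n"] by simp
  qed
  finally show ?case by simp
qed

lemma fixed_point_snth:
  assumes "constant_length \<rho> L" and "fixed_point \<rho> w" and "i < L"
  shows "w !! (L * m + i) = column \<rho> i (w !! m)"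
proof -
  have "flat (smap \<rho> w) !! (L * m + i) = smap \<rho> w !! m ! i"
    using assms by (intro flat_snth_constant_length) (auto simp: constant_length_def)
  then show ?thesis
    using assms(2) by (simp add: fixed_point_def subst_stream_def column_def)
qed

text \<open>The permutation is the composition of the columns indexed by the \<open>n\<close>
  base-\<open>L\<close> digits of \<open>i\<close>; the induction splits off the last digit.\<close>

lemma fixed_point_snth_power:
  assumes "constant_length \<rho> L" and "bijective_subst \<rho> L" and "fixed_point \<rho> w"
    and "i < L ^ n"
  shows "\<exists>f. bij f \<and> (\<forall>q. w !! (L ^ n * q + i) = f (w !! q))"
  using assms(4)
proof (induction n arbitrary: i)
  case 0
  then show ?case by (intro exI[of _ id] conjI bij_id) simp
next
  case (Suc n)
  have "L > 0" using Suc.prems by (cases L) auto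
  have "i div L < L ^ n" using Suc.prems by (simp add: less_mult_imp_div_less mult.commute)
  then obtain f where f: "bij f" "\<And>q. w !! (L ^ n * q + i div L) = f (w !! q)"
    using Suc.IH by blast
  have il: "i mod L < L" using \<open>L > 0\<close> by simp
  have "w !! (L ^ Suc n * q + i) = (column \<rho> (i mod L) \<circ> f) (w !! q)" for q
  proof -
    have "L ^ Suc n * q + i = L * (L ^ n * q + i div L) + i mod L"
      by (simp add: algebra_simps)
    then show ?thesis
      using fixed_point_snth[OF assms(1,3) il, of "L ^ n * q + i div L"] f(2) by simp
  qed
  moreover have "bij (column \<rho> (i mod L) \<circ> f)"
    using f(1) il assms(2) by (auto simp: bijective_subst_def intro: bij_comp)
  ultimately show ?case by blast
qed

text \<open>Turns primitivity into a statement about positions: for a suitable \<open>n\<close>,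
  every letter occurs in each block of \<open>w\<close> that starts at a multiple of
  \<open>L ^ n\<close> and has length \<open>L ^ n\<close>.\<close>

lemma set_subst_word_power_fixed_point:
  assumes "constant_length \<rho> L" and "fixed_point \<rho> w"
  shows "set ((subst_word \<rho> ^^ n) [w !! i]) \<subseteq> (\<lambda>j. w !! (L ^ n * i + j)) ` {..<L ^ n}"
proof (induction n)
  case 0
  then show ?case by simp
next
  case (Suc n)
  show ?case
  proof
    fix x assume "x \<in> set ((subst_word \<rho> ^^ Suc n) [w !! i])"
    then obtain b where b: "b \<in> set ((subst_word \<rho> ^^ n) [w !! i])" and x: "x \<in> set (\<rho> b)"
      by (auto simp: subst_word_def)
    from b Suc.IH obtain j where j: "j < L ^ n" "b = w !! (L ^ n * i + j)" by auto
    from x obtain l where l: "l < L" "x = column \<rho> l b"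
      using assms(1) by (auto simp: in_set_conv_nth constant_length_def column_def)
    have "L * j + l < L * Suc j" using l by simp
    also have "\<dots> \<le> L * L ^ n" using j by (intro mult_le_mono) auto
    finally have "L * j + l < L ^ Suc n" by simp
    moreover have "x = w !! (L ^ Suc n * i + (L * j + l))"
      using fixed_point_snth[OF assms l(1), of "L ^ n * i + j"] j l
      by (simp add: algebra_simps)
    ultimately show "x \<in> (\<lambda>j. w !! (L ^ Suc n * i + j)) ` {..<L ^ Suc n}" by blast
  qed
qed

section \<open>Boundedness of progressions whose difference is coprime to \<open>L\<close>\<close>

lemma stream_eqI_snth:
  assumes "\<And>n. s !! n = t !! n"
  shows "s = t"
  using assms by (metis ext stream_smap_nats)

lemma cycle_stake_if_periodic:
  assumes "d \<ge> 1" and "\<And>i. w !! (i + d) = w !! i"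
  shows "cycle (stake d w) = w"
proof (rule stream_eqI_snth)
  fix n
  have ne: "stake d w \<noteq> []" using assms(1) by (metis length_0_conv length_stake not_one_le_zero)
  show "cycle (stake d w) !! n = w !! n"
  proof (induction n rule: less_induct)
    case (less n)
    have split: "cycle (stake d w) = stake d w @- cycle (stake d w)"
      using cycle_decomp[OF ne] .
    show ?case
    proof (cases "n < d")
      case True
      then show ?thesis by (subst split) (simp add: stake_nth)
    next
      case False
      then have "cycle (stake d w) !! n = cycle (stake d w) !! (n - d)"
        by (subst split) simp
      also have "\<dots> = w !! (n - d)" using less False assms(1) by auto
      also have "\<dots> = w !! n" using assms(2)[of "n - d"] False by simp
      finally show ?thesis .
    qed
  qed
qed

lemma arith_progression_meets_residue_class:
  fixes d N i k :: nat
  assumes "coprime d N" and "i < N"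
  obtains n where "n < N" and "(k + d * n) mod N = i"
proof -
  obtain x where x: "[d * x = 1] (mod N)"
    using cong_solve_coprime_nat[OF assms(1)] by auto
  \<comment> \<open>A representative of \<open>i - k\<close> modulo \<open>N\<close>; adding
    \<open>N * k\<close> keeps the natural subtraction from truncating.\<close>
  define y where "y = i + N * k - k"
  have "k \<le> N * k" using assms(2) by (cases N) auto
  then have y: "k + y = i + N * k" unfolding y_def by linarith
  have "[k + d * (x * y mod N) = k + d * (x * y)] (mod N)"
    by (intro cong_add cong_mult cong_refl) (simp add: cong_def)
  also have "[k + d * (x * y) = k + 1 * y] (mod N)"
    using cong_mult[OF x cong_refl[of y]] by (intro cong_add cong_refl) (simp add: mult.assoc)
  also have "[k + 1 * y = i] (mod N)" using y by (simp add: cong_def)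
  finally have "(k + d * (x * y mod N)) mod N = i"
    using assms(2) by (simp add: cong_def)
  moreover have "x * y mod N < N" using assms(2) by simp
  ultimately show ?thesis using that by blast
qed

lemma letter_periodic_if_long_mono_ap:
  assumes "constant_length \<rho> L" and "bijective_subst \<rho> L" and "fixed_point \<rho> w"
    and "L \<ge> 2" and "coprime d L"
    and unbounded: "\<And>M. \<exists>k. w !! k = a \<and> mono_ap w d k M"
    and "w !! i = a"
  shows "w !! (i + d) = a"
proof -
  \<comment> \<open>Any power of \<open>L\<close> above \<open>i + d\<close> would do:
    \<open>i\<close> and \<open>i + d\<close> become offsets in one block of length
    \<open>N\<close>.\<close>
  define N where "N = L ^ (i + d)"
  have "i + d < N" using assms(4) unfolding N_def by (metis less_exp order_less_le_trans power_mono zero_le)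
  \<comment> \<open>The extra term ensures that the successor of the term found in class
    \<open>i\<close> still belongs to the progression.\<close>
  obtain k where k: "w !! k = a" "mono_ap w d k (N + 1)" using unbounded by blast
  have ap: "w !! (k + d * n) = a" if "n \<le> N" for n
    using k that by (auto simp: mono_ap_def less_Suc_eq_le)
  have "coprime d N" using assms(5) by (simp add: N_def)
  then obtain n where n: "n < N" "(k + d * n) mod N = i"
    using arith_progression_meets_residue_class \<open>i + d < N\<close> by (metis add_lessD1)
  define q where "q = (k + d * n) div N"
  have q: "k + d * n = N * q + i" using n(2) by (simp add: q_def) (metis mult_div_mod_eq)
  obtain f where f: "bij f" "\<And>q. w !! (N * q + i) = f (w !! q)"
    using fixed_point_snth_power[OF assms(1-3), of i "i + d"] \<open>i + d < N\<close> unfolding N_def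
    by (metis add_lessD1)
  obtain g where g: "\<And>q. w !! (N * q + (i + d)) = g (w !! q)"
    using fixed_point_snth_power[OF assms(1-3), of "i + d" "i + d"] \<open>i + d < N\<close> unfolding N_def
    by blast
  have "f (w !! q) = f (w !! 0)"
    using f(2)[of q] f(2)[of 0] ap[of n] n(1) q assms(7) by simp
  \<comment> \<open>Injectivity at the single offset \<open>i\<close> identifies the letters
    underlying block \<open>q\<close> and the prefix, so the two also agree at offset
    \<open>i + d\<close>, where the next term lies.\<close>
  then have "w !! q = w !! 0" using f(1) by (simp add: bij_def inj_eq)
  then have "w !! (N * q + (i + d)) = w !! (i + d)" using g[of q] g[of 0] by simp
  moreover have "N * q + (i + d) = k + d * Suc n" using q by simp
  ultimately show ?thesis using ap[of "Suc n"] n(1) by simp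
qed

text \<open>The image block of any letter contains \<open>a\<close>. Making \<open>L ^ n\<close>
  steps of size \<open>d\<close> from there leads to the same offset in the block of index
  \<open>i + d\<close>, and the permutation at this offset is injective.\<close>

lemma periodic_if_letter_periodic:
  assumes "constant_length \<rho> L" and "bijective_subst \<rho> L" and "fixed_point \<rho> w"
    and "primitive_subst \<rho>"
    and a: "\<And>i. w !! i = a \<Longrightarrow> w !! (i + d) = a"
  shows "w !! (i + d) = w !! i"
proof -
  obtain n where "set ((subst_word \<rho> ^^ n) [w !! i]) = UNIV"
    using assms(4) by (auto simp: primitive_subst_def)
  then have "a \<in> (\<lambda>j. w !! (L ^ n * i + j)) ` {..<L ^ n}"
    using set_subst_word_power_fixed_point[OF assms(1,3), of n i] by blast
  then obtain j where j: "j < L ^ n" "w !! (L ^ n * i + j) = a" by blast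
  obtain f where f: "bij f" "\<And>q. w !! (L ^ n * q + j) = f (w !! q)"
    using fixed_point_snth_power[OF assms(1-3) j(1)] by blast
  have "w !! (L ^ n * i + j + m * d) = a" for m
  proof (induction m)
    case (Suc m)
    then show ?case using a[OF Suc] by (simp add: algebra_simps)
  qed (use j in simp)
  from this[of "L ^ n"] have "f (w !! (i + d)) = f (w !! i)"
    using f(2)[of "i + d"] f(2)[of i] j(2) by (simp add: algebra_simps)
  then show ?thesis using f(1) by (simp add: bij_def inj_eq)
qed

lemma max_ap_length_finite:
  fixes \<rho> :: "'a::finite \<Rightarrow> 'a list"
  assumes "constant_length \<rho> L" and "bijective_subst \<rho> L" and "fixed_point \<rho> w"
    and "primitive_subst \<rho>" and "aperiodic_subst \<rho>"
    and "L \<ge> 2" and "coprime d L" and "d \<ge> 1"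
  shows "max_ap_length w d \<noteq> \<infinity>"
proof -
  have "\<exists>M. \<forall>k. w !! k = a \<longrightarrow> \<not> mono_ap w d k M" for a
  proof (rule ccontr)
    assume "\<not> ?thesis"
    then have "\<And>M. \<exists>k. w !! k = a \<and> mono_ap w d k M" by blast
    then have "\<And>i. w !! i = a \<Longrightarrow> w !! (i + d) = a"
      using letter_periodic_if_long_mono_ap[OF assms(1-3,6,7)] by blast
    then have "\<And>i. w !! (i + d) = w !! i"
      using periodic_if_letter_periodic[OF assms(1-4)] by blast
    then have "cycle (stake d w) = w" using cycle_stake_if_periodic \<open>d \<ge> 1\<close> by blast
    moreover have "stake d w \<noteq> []"
      using \<open>d \<ge> 1\<close> by (metis length_0_conv length_stake not_one_le_zero)
    ultimately show False using assms(3,5) unfolding aperiodic_subst_def by metis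
  qed
  then obtain B where B: "\<And>a k. w !! k = a \<Longrightarrow> \<not> mono_ap w d k (B a)" by metis
  have "enat M \<le> enat (Max (range B))" if "mono_ap w d k M" for k M
  proof -
    \<comment> \<open>Initial segments of a monochromatic progression are monochromatic, so
      excluding one length excludes all larger ones.\<close>
    have "\<not> B (w !! k) \<le> M" using that B[of k "w !! k"] by (auto simp: mono_ap_def)
    moreover have "B (w !! k) \<le> Max (range B)" by simp
    ultimately show ?thesis by (metis enat_ord_simps(1) le_trans nat_le_linear)
  qed
  then have "max_ap_length w d \<le> enat (Max (range B))"
    unfolding max_ap_length_def by (auto intro!: Sup_least)
  then show ?thesis by (cases "max_ap_length w d") auto
qed

lemma constant_length_ge_2:
  fixes \<rho> :: "'a::finite \<Rightarrow> 'a list"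
  assumes "substitution \<rho>" and "constant_length \<rho> L" and "primitive_subst \<rho>"
    and "aperiodic_subst \<rho>" and "fixed_point \<rho> w"
  shows "L \<ge> 2"
proof (rule ccontr)
  assume "\<not> L \<ge> 2"
  moreover have "L \<noteq> 0"
    using assms(1,2) unfolding substitution_def constant_length_def by fastforce
  ultimately have "L = 1" by simp
  obtain n where "set ((subst_word \<rho> ^^ n) [w !! 0]) = UNIV"
    using assms(3) by (auto simp: primitive_subst_def)
  then have "(UNIV :: 'a set) \<subseteq> {w !! (L ^ n * 0)}"
    using set_subst_word_power_fixed_point[OF assms(2,5), of n 0] \<open>L = 1\<close> by auto
  \<comment> \<open>For \<open>L = 1\<close> primitivity leaves a single letter, which makes
    \<open>w\<close> constant.\<close>
  then have "x = y" for x y :: 'a by (metis UNIV_I singletonD subset_iff)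
  then have "cycle [w !! 0] = w" by (intro stream_eqI_snth)
  then show False using assms(4,5) unfolding aperiodic_subst_def by (metis list.distinct(1))
qed

section \<open>Long monochromatic progressions\<close>

lemma common_period_of_bijections:
  obtains s where "s \<ge> 1" and "\<And>(f :: 'a::finite \<Rightarrow> 'a) x. bij f \<Longrightarrow> (f ^^ Suc s) x = x"
proof -
  have "\<exists>n>0. (f ^^ n) x = x" if "bij f" for f :: "'a \<Rightarrow> 'a" and x
    using funpow_inj_finite[of f x] that by (metis bij_def finite)
  then obtain N where N: "\<And>(f :: 'a \<Rightarrow> 'a) x. bij f \<Longrightarrow> N f x > 0 \<and> (f ^^ N f x) x = x"
    by metis
  define P where "P = (\<Prod>(f, x) \<in> {f :: 'a \<Rightarrow> 'a. bij f} \<times> UNIV. N f x)"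
  have "P > 0" unfolding P_def by (rule prod_pos) (use N in auto)
  \<comment> \<open>Doubling the common period \<open>P\<close> makes it at least 2, so that
    \<open>s = 2 * P - 1\<close> is positive.\<close>
  have "(f ^^ (2 * P)) x = x" if "bij f" for f :: "'a \<Rightarrow> 'a" and x
  proof -
    have "N f x dvd P" unfolding P_def
      using dvd_prodI[of "{f :: 'a \<Rightarrow> 'a. bij f} \<times> UNIV" "(f, x)" "\<lambda>(f, x). N f x"] that by auto
    then obtain m where m: "2 * P = N f x * m" by (metis dvd_def dvd_mult)
    have "((f ^^ N f x) ^^ m) x = x" using N[OF that] by (induction m) auto
    then show ?thesis by (simp only: m funpow_mult mult.commute[of m])
  qed
  then show ?thesis using that[of "2 * P - 1"] \<open>P > 0\<close> by simp
qed

text \<open>All \<open>r\<close> digits of \<open>k * (\<Sum>j<r. X ^ j)\<close> in base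
  \<open>X\<close> are \<open>k\<close> when \<open>k < X\<close>, so the same map is applied
  \<open>r\<close> times.\<close>

lemma snth_mult_geometric_sum:
  assumes "\<And>q. w !! (X * q + k) = f (w !! q)"
  shows "w !! (k * (\<Sum>j<r. X ^ j)) = (f ^^ r) (w !! 0)"
proof (induction r)
  case (Suc r)
  have "k * (\<Sum>j<Suc r. X ^ j) = X * (k * (\<Sum>j<r. X ^ j)) + k"
    by (simp add: sum.lessThan_Suc_shift sum_distrib_left algebra_simps del: sum.lessThan_Suc)
  then show ?case using assms Suc.IH by simp
qed simp

lemma max_ap_length_ge:
  fixes \<rho> :: "'a::finite \<Rightarrow> 'a list"
  assumes "constant_length \<rho> L" and "bijective_subst \<rho> L" and "fixed_point \<rho> w"
    and period: "\<And>(f :: 'a \<Rightarrow> 'a) x. bij f \<Longrightarrow> (f ^^ r) x = x"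
  shows "enat (L ^ n) \<le> max_ap_length w (\<Sum>j<r. (L ^ n) ^ j)"
proof -
  have "w !! (k * (\<Sum>j<r. (L ^ n) ^ j)) = w !! 0" if k: "k < L ^ n" for k
  proof -
    obtain f where "bij f" "\<And>q. w !! (L ^ n * q + k) = f (w !! q)"
      using fixed_point_snth_power[OF assms(1-3) k] by blast
    then show ?thesis using snth_mult_geometric_sum[of w "L ^ n" k f r] period by simp
  qed
  then have "mono_ap w (\<Sum>j<r. (L ^ n) ^ j) 0 (L ^ n)"
    by (simp add: mono_ap_def mult.commute)
  then show ?thesis unfolding max_ap_length_def by (auto intro!: Sup_upper)
qed

section \<open>Asymptotics and the choice of differences\<close>

lemma asymp_equiv_geometric_sum_root:
  fixes X :: "nat \<Rightarrow> real"
  assumes "s \<ge> 1" and "filterlim X at_top sequentially" and "\<And>n. X n > 0"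
  shows "X \<sim>[sequentially] (\<lambda>n. (\<Sum>j<Suc s. X n ^ j) powr (1 / real s))"
proof -
  \<comment> \<open>Factoring out the leading power leaves a sum in \<open>inverse (X n)\<close>
    that tends to its term for \<open>j = 0\<close>, which is 1.\<close>
  have eq: "(\<Sum>j<Suc s. X n ^ j) = X n ^ s * (\<Sum>j<Suc s. inverse (X n) ^ j)" for n
  proof -
    have "(\<Sum>j<Suc s. X n ^ j) = (\<Sum>j<Suc s. X n ^ (Suc s - Suc j))"
      by (rule sum.nat_diff_reindex[symmetric])
    also have "\<dots> = (\<Sum>j<Suc s. X n ^ s * inverse (X n) ^ j)"
      using assms(3)[of n] by (intro sum.cong) (auto simp: power_diff field_simps)
    finally show ?thesis by (simp only: sum_distrib_left)
  qed
  have pos: "(\<Sum>j<Suc s. inverse (X n) ^ j) > 0" for n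
    using assms(3)[of n] by (intro sum_pos) auto
  have "(X n ^ s) powr (1 / real s) = X n" for n
    using assms(1) assms(3)[of n] by (simp add: powr_powr flip: powr_realpow)
  then have rhs: "(\<Sum>j<Suc s. X n ^ j) powr (1 / real s) =
      X n * (\<Sum>j<Suc s. inverse (X n) ^ j) powr (1 / real s)" for n
    unfolding eq using pos[of n] assms(3)[of n] by (subst powr_mult) auto
  have "(\<lambda>n. inverse (X n)) \<longlonglongrightarrow> 0"
    using assms(2) by (rule tendsto_inverse_0_at_top)
  then have "(\<lambda>n. \<Sum>j<Suc s. inverse (X n) ^ j) \<longlonglongrightarrow> (\<Sum>j<Suc s. 0 ^ j)"
    by (intro tendsto_sum tendsto_power)
  moreover have "(\<Sum>j<Suc s. (0 :: real) ^ j) = 1"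
    by (simp add: sum.lessThan_Suc_shift del: sum.lessThan_Suc)
  ultimately have "(\<lambda>n. (\<Sum>j<Suc s. inverse (X n) ^ j) powr (1 / real s)) \<longlonglongrightarrow> 1 powr (1 / real s)"
    by (intro tendsto_powr tendsto_const) auto
  then have "(\<lambda>n. (\<Sum>j<Suc s. X n ^ j) powr (1 / real s)) \<sim>[sequentially] X"
    by (intro asymp_equivI') (use assms(3) in \<open>simp add: rhs less_imp_neq[symmetric] del: sum.lessThan_Suc\<close>)
  then show ?thesis by (rule asymp_equiv_symI)
qed

theorem theorem1:
  fixes \<rho> :: "'a::finite \<Rightarrow> 'a list" and L :: nat and w :: "'a stream"
  assumes "substitution \<rho>"
    and "constant_length \<rho> L"
    and "bijective_subst \<rho> L"
    and "primitive_subst \<rho>"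
    and "aperiodic_subst \<rho>"
    and "fixed_point \<rho> w"
  shows "\<exists>(d :: nat \<Rightarrow> nat) (\<alpha> :: real).
           strict_mono d \<and> (\<forall>n. 1 \<le> d n) \<and> 0 < \<alpha> \<and> \<alpha> \<le> 1 \<and>
           (\<forall>n. max_ap_length w (d n) \<noteq> \<infinity>) \<and>
           asymp_ge (\<lambda>n. real (the_enat (max_ap_length w (d n)))) (\<lambda>n. real (d n) powr \<alpha>)"
proof -
  have L: "L \<ge> 2" using constant_length_ge_2 assms by blast
  obtain s where s: "s \<ge> 1" "\<And>(f :: 'a \<Rightarrow> 'a) x. bij f \<Longrightarrow> (f ^^ Suc s) x = x"
    using common_period_of_bijections by blast
  \<comment> \<open>The exponent \<open>Suc n\<close> makes \<open>L\<close> divide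
    \<open>X n\<close> also for \<open>n = 0\<close>, so every \<open>d n\<close> is 1 modulo
    \<open>L\<close>.\<close>
  define X where "X n = L ^ Suc n" for n
  define d where "d n = (\<Sum>j<Suc s. X n ^ j)" for n
  have X_pos: "X n > 0" for n using L by (simp add: X_def)
  have d_eq: "d n = 1 + X n * (\<Sum>j<s. X n ^ j)" for n
    unfolding d_def
    by (simp add: sum.lessThan_Suc_shift sum_distrib_left del: sum.lessThan_Suc)
  have "strict_mono d"
  proof (rule strict_mono_Suc_iff[THEN iffD2], rule allI)
    fix n
    have "X n < X (Suc n)" using L by (simp add: X_def)
    \<comment> \<open>Here \<open>s \<ge> 1\<close> matters: for \<open>s = 0\<close> all
      \<open>d n\<close> would equal 1.\<close>
    moreover have "(\<Sum>j<s. X n ^ j) > 0"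
      using s(1) X_pos by (intro sum_pos) (auto simp: lessThan_empty_iff)
    ultimately have "X n * (\<Sum>j<s. X n ^ j) < X (Suc n) * (\<Sum>j<s. X (Suc n) ^ j)"
      by (intro mult_less_le_imp_less sum_mono power_mono) auto
    then show "d n < d (Suc n)" by (simp add: d_eq)
  qed
  have d_ge: "d n \<ge> 1" for n by (simp add: d_eq)
  have coprime: "coprime (d n) L" for n
  proof -
    have "d n = 1 + (L ^ n * (\<Sum>j<s. X n ^ j)) * L" by (simp add: d_eq X_def)
    then show ?thesis by (metis coprime_1_left coprime_iff_gcd_eq_1 gcd_add_mult gcd.commute add.commute)
  qed
  \<comment> \<open>Finiteness also lets \<open>the_enat\<close> preserve the lower bound
    \<open>X n\<close>.\<close>
  have fin: "max_ap_length w (d n) \<noteq> \<infinity>" for n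
    using max_ap_length_finite[OF assms(2,3,6,4,5) L coprime d_ge] .
  have "real (X n) \<le> real (the_enat (max_ap_length w (d n)))" for n
  proof -
    have "enat (X n) \<le> max_ap_length w (d n)"
      unfolding d_def X_def by (rule max_ap_length_ge[OF assms(2,3,6) s(2)])
    then show ?thesis using fin[of n] by auto
  qed
  moreover have "(\<lambda>n. real (X n)) \<sim>[sequentially] (\<lambda>n. real (d n) powr (1 / real s))"
  proof -
    have "n \<le> X n" for n
    proof -
      have "n < 2 ^ Suc n" by (meson Suc_lessD less_exp)
      also have "\<dots> \<le> X n" using L unfolding X_def by (intro power_mono) auto
      finally show ?thesis by simp
    qed
    then have "filterlim (\<lambda>n. real (X n)) at_top sequentially"
      by (intro filterlim_at_top_mono[OF filterlim_real_sequentially] always_eventually) simp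
    then show ?thesis
      using asymp_equiv_geometric_sum_root[OF s(1), of "\<lambda>n. real (X n)"] X_pos
      by (simp add: d_def del: sum.lessThan_Suc)
  qed
  ultimately have "asymp_ge (\<lambda>n. real (the_enat (max_ap_length w (d n))))
      (\<lambda>n. real (d n) powr (1 / real s))"
    unfolding asymp_ge_def using X_pos by (intro exI[of _ "\<lambda>n. real (X n)"]) auto
  then show ?thesis
    using \<open>strict_mono d\<close> d_ge fin s(1)
    by (intro exI[of _ d] exI[of _ "1 / real s"]) auto
qed

end
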